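(* Let $X=(x_{st})_{n\times n}$ be a symmetric matrix of order $n$ over the complex field. For $1\le i,j\le n$ let $X_{[ij]}$ be the symmetric matrix obtained from $X$ by replacing the $(i,j)$-entry and the $(j,i)$-entry with $0$. Then $$\frac{1}{2}(n^2-n)\det(X)=\sum_{1\le i\le j\le n}\det(X_{[ij]})+\sum_{1\le i<j\le n}x_{ij}^2\det(X^{i,j}_{i,j}).$$
   Context: $X^{i,j}_{i,j}$ denotes the submatrix of $X$ obtained by deleting rows $i,j$ and columns $i,j$; the determinant of the empty ($0\times 0$) matrix is $1$. Symmetric means $x_{st}=x_{ts}$ (no complex conjugation). *)

theory Defs
  imports Complex_Main "Jordan_Normal_Form.Determinant" "Jordan_Normal_Form.DL_Submatrix"
begin

text \<open>Matrices are indexed from 0, so the index range from 1 to n becomes the range of indices below n.\<close>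

definition zero_entries :: "'a :: zero mat \<Rightarrow> nat \<Rightarrow> nat \<Rightarrow> 'a mat" where
  "zero_entries X i j = (X |\<^sub>m (i, j) \<mapsto> 0) |\<^sub>m (j, i) \<mapsto> 0"

text \<open>In \<open>submatrix\<close> the index sets are those of the rows and columns that are kept,
  hence the complement.\<close>

definition principal_delete2 :: "'a mat \<Rightarrow> nat \<Rightarrow> nat \<Rightarrow> 'a mat" where
  "principal_delete2 X i j = submatrix X (- {i, j}) (- {i, j})"

end

theory Submission
  imports Defs
begin

text \<open>The determinant is affine in each entry, with the cofactor as slope, so zeroing the entries
  at \<open>(i, j)\<close> and \<open>(j, i)\<close> for \<open>i < j\<close> subtracts the two corresponding Laplace terms and
  \<open>x\<^sub>i\<^sub>j x\<^sub>j\<^sub>i\<close> times the complementary minor; zeroing a diagonal entry subtracts one Laplace term.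
  Over all pairs every Laplace term is subtracted exactly once, which by the \<open>n\<close> row expansions
  amounts to \<open>n det X\<close>, and \<open>n + n (n - 1) / 2\<close> copies of \<open>det X\<close> are available.\<close>

text \<open>Expansion along row \<open>i\<close>: its cofactors omit that row, so the update leaves
  them alone and changes only the \<open>j\<close>-th term.\<close>

lemma det_update_mat:
  assumes A: "A \<in> carrier_mat n n" and i: "i < n" and j: "j < n"
  shows "det (A |\<^sub>m (i, j) \<mapsto> v) = det A + (v - A $$ (i, j)) * cofactor A i j"
proof -
  let ?B = "A |\<^sub>m (i, j) \<mapsto> v"
  have B: "?B \<in> carrier_mat n n" using A by auto
  have "mat_delete ?B i k = mat_delete A i k" if "k < n" for k
    using A i that by (auto intro!: eq_matI simp: mat_delete_def update_mat_def)
  then have cof: "cofactor ?B i k = cofactor A i k" if "k < n" for k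
    using that by (simp add: cofactor_def)
  have "det ?B = (\<Sum>k<n. ?B $$ (i, k) * cofactor A i k)"
    by (simp add: laplace_expansion_row[OF B i] cof)
  also have "\<dots> = (\<Sum>k<n. A $$ (i, k) * cofactor A i k
      + (if k = j then (v - A $$ (i, j)) * cofactor A i j else 0))"
    using A i by (intro sum.cong) (auto simp: algebra_simps)
  also have "\<dots> = det A + (v - A $$ (i, j)) * cofactor A i j"
    using j by (simp add: sum.distrib laplace_expansion_row[OF A i])
  finally show ?thesis .
qed

text \<open>\<open>pick S k\<close> is the element of \<open>S\<close> with exactly \<open>k\<close>
  smaller elements in \<open>S\<close>, so it suffices to count below the claimed value. The
  threshold is \<open>j - 1\<close> because \<open>i\<close> has already been skipped.\<close>

lemma pick_Compl2:
  assumes "i < j"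
  shows "pick (- {i, j}) k = (if k < i then k else if k < j - 1 then Suc k else Suc (Suc k))"
    (is "_ = ?m")
proof -
  have "{a \<in> - {i, j}. a < ?m} = {..<?m} - ({i, j} \<inter> {..<?m})" by auto
  then have "card {a \<in> - {i, j}. a < ?m} = ?m - card ({i, j} \<inter> {..<?m})"
    by (simp add: card_Diff_subset)
  also have "{i, j} \<inter> {..<?m} = (if k < i then {} else if k < j - 1 then {i} else {i, j})"
    using assms by auto
  finally have "card {a \<in> - {i, j}. a < ?m} = k"
    using assms by (simp split: if_splits)
  moreover have "?m \<in> - {i, j}" using assms by auto
  ultimately show ?thesis using pick_card_in_set[of ?m "- {i, j}"] by simp
qed

text \<open>Since \<open>i < j\<close>, deleting row \<open>j\<close> and column \<open>i\<close>
  leaves row \<open>i\<close> in place but moves column \<open>j\<close> to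
  \<open>j - 1\<close>.\<close>

lemma principal_delete2_eq_mat_delete:
  assumes A: "A \<in> carrier_mat n n" and ij: "i < j" "j < n"
  shows "principal_delete2 A i j = mat_delete (mat_delete A j i) i (j - 1)"
proof -
  have "{a. a < n \<and> a \<in> - {i, j}} = {..<n} - {i, j}" by auto
  then have card: "card {a. a < n \<and> a \<in> - {i, j}} = n - 2"
    using ij by (simp add: card_Diff_subset)
  show ?thesis
    unfolding principal_delete2_def submatrix_def mat_delete_def
    using A card ij by (auto intro!: eq_matI simp: pick_Compl2)
qed

text \<open>The minor at \<open>(j, i)\<close> still contains the entry \<open>(i, j)\<close>, now
  at \<open>(i, j - 1)\<close>, so zeroing it is again an affine update, with the doubly deleted
  minor in its slope.\<close>

lemma cofactor_update_transposed:
  fixes A :: "'a :: comm_ring_1 mat"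
  assumes A: "A \<in> carrier_mat n n" and ij: "i < j" "j < n"
  shows "cofactor (A |\<^sub>m (i, j) \<mapsto> 0) j i =
    cofactor A j i + A $$ (i, j) * det (principal_delete2 A i j)"
proof -
  let ?D = "mat_delete A j i"
  have D: "?D \<in> carrier_mat (n - 1) (n - 1)"
    using A ij by (auto simp: mat_delete_def)
  have "mat_delete (A |\<^sub>m (i, j) \<mapsto> 0) j i = ?D |\<^sub>m (i, j - 1) \<mapsto> 0"
    using A ij by (auto intro!: eq_matI simp: mat_delete_def update_mat_def)
  moreover have "?D $$ (i, j - 1) = A $$ (i, j)"
    using A ij by (auto simp: mat_delete_def)
  ultimately have "det (mat_delete (A |\<^sub>m (i, j) \<mapsto> 0) j i) =
      det ?D - A $$ (i, j) * ((-1) ^ (i + (j - 1)) * det (principal_delete2 A i j))"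
    using det_update_mat[OF D, of i "j - 1" 0] ij
    by (simp add: cofactor_def principal_delete2_eq_mat_delete[OF A ij])
  \<comment> \<open>The two cofactor signs are opposite, which turns the subtracted term into an
    added one.\<close>
  moreover have "(-1 :: 'a) ^ (j + i) = - ((-1) ^ (i + (j - 1)))"
    using ij by (cases j) (auto simp: add.commute)
  moreover have "(-1 :: 'a) ^ k * ((-1) ^ k * x) = x" for k x
    by (simp flip: power_mult_distrib mult.assoc)
  ultimately show ?thesis
    by (simp add: cofactor_def right_diff_distrib mult.left_commute[of "A $$ (i, j)"])
qed

text \<open>On the diagonal both updates hit the same entry, so only one Laplace term is
  lost.\<close>

lemma det_zero_entries_diag:
  fixes A :: "'a :: comm_ring_1 mat"
  assumes "A \<in> carrier_mat n n" and "i < n"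
  shows "det (zero_entries A i i) = det A - A $$ (i, i) * cofactor A i i"
proof -
  have "zero_entries A i i = A |\<^sub>m (i, i) \<mapsto> 0"
    by (auto intro!: eq_matI simp: zero_entries_def update_mat_def)
  then show ?thesis using det_update_mat[OF assms(1) assms(2) assms(2), of 0] by simp
qed

text \<open>The slope of the second update is a cofactor of the matrix already updated once; its
  correction produces the complementary minor.\<close>

lemma det_zero_entries:
  fixes A :: "'a :: comm_ring_1 mat"
  assumes A: "A \<in> carrier_mat n n" and ij: "i < j" "j < n"
  shows "det (zero_entries A i j) = det A - A $$ (i, j) * cofactor A i j
    - A $$ (j, i) * cofactor A j i - A $$ (i, j) * A $$ (j, i) * det (principal_delete2 A i j)"
proof -
  have "A |\<^sub>m (i, j) \<mapsto> 0 \<in> carrier_mat n n" using A by auto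
  from det_update_mat[OF this, of j i 0] show ?thesis
    using A ij det_update_mat[OF A, of i j 0]
    by (simp add: zero_entries_def cofactor_update_transposed[OF A ij] algebra_simps)
qed

lemma sum_triangle:
  fixes f :: "nat \<Rightarrow> nat \<Rightarrow> 'a :: comm_monoid_add"
  shows "(\<Sum>(i, j)\<in>{(i, j). i \<le> j \<and> j < n}. f i j) =
    (\<Sum>i<n. f i i) + (\<Sum>(i, j)\<in>{(i, j). i < j \<and> j < n}. f i j)"
proof -
  let ?L = "{(i, j). i < j \<and> j < n}" and ?D = "(\<lambda>i. (i, i)) ` {..<n}"
  have "finite ?L" by (rule finite_subset[of _ "{..<n} \<times> {..<n}"]) auto
  moreover have "{(i, j). i \<le> j \<and> j < n} = ?D \<union> ?L" by auto
  ultimately show ?thesis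
    by (simp add: sum.union_disjoint disjoint_iff sum.reindex inj_on_def image_iff)
qed

lemma sum_square:
  fixes f :: "nat \<Rightarrow> nat \<Rightarrow> 'a :: comm_monoid_add"
  shows "(\<Sum>i<n. \<Sum>j<n. f i j) =
    (\<Sum>i<n. f i i) + (\<Sum>(i, j)\<in>{(i, j). i < j \<and> j < n}. f i j + f j i)"
proof -
  let ?L = "{(i, j). i < j \<and> j < n}" and ?U = "{(i, j). i \<le> j \<and> j < n}"
  have fin: "finite ?L" "finite ?U" by (rule finite_subset[of _ "{..<n} \<times> {..<n}"]; auto)+
  \<comment> \<open>The part below the diagonal is the mirror image of \<open>?L\<close>.\<close>
  have "{..<n} \<times> {..<n} = ?U \<union> prod.swap ` ?L" by (auto simp: image_iff)
  moreover have "?U \<inter> prod.swap ` ?L = {}" by auto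
  ultimately have "(\<Sum>i<n. \<Sum>j<n. f i j) =
      (\<Sum>(i, j)\<in>?U. f i j) + (\<Sum>(i, j)\<in>prod.swap ` ?L. f i j)"
    using fin by (simp add: sum.cartesian_product sum.union_disjoint)
  also have "(\<Sum>(i, j)\<in>prod.swap ` ?L. f i j) = (\<Sum>(i, j)\<in>?L. f j i)"
    by (subst sum.reindex) (auto intro: sum.cong)
  also have "(\<Sum>(i, j)\<in>?U. f i j) + \<dots> =
      (\<Sum>i<n. f i i) + ((\<Sum>(i, j)\<in>?L. f i j) + (\<Sum>(i, j)\<in>?L. f j i))"
    by (simp only: sum_triangle add.assoc)
  finally show ?thesis
    by (simp add: sum.distrib case_prod_unfold)
qed

theorem theorem2p1:
  fixes X :: "complex mat" and n :: nat
  assumes "X \<in> carrier_mat n n"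
    and "transpose_mat X = X"
  shows "1 / 2 * ((of_nat n)\<^sup>2 - of_nat n) * det X =
    (\<Sum>(i, j) \<in> {(i, j). i \<le> j \<and> j < n}. det (zero_entries X i j)) +
    (\<Sum>(i, j) \<in> {(i, j). i < j \<and> j < n}. (X $$ (i, j))\<^sup>2 * det (principal_delete2 X i j))"
proof -
  let ?L = "{(i, j). i < j \<and> j < n}"
  let ?t = "\<lambda>i j. X $$ (i, j) * cofactor X i j"
  let ?e = "\<lambda>i j. (X $$ (i, j))\<^sup>2 * det (principal_delete2 X i j)"
  \<comment> \<open>Symmetry turns the product of the two zeroed entries into a square.\<close>
  have sym: "X $$ (j, i) = X $$ (i, j)" if "i < n" "j < n" for i j
    using assms that by (metis carrier_matD index_transpose_mat(1))
  have "(\<Sum>(i, j)\<in>?L. det (zero_entries X i j)) =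
      (\<Sum>(i, j)\<in>?L. det X - (?t i j + ?t j i) - ?e i j)"
    by (intro sum.cong)
      (auto simp: det_zero_entries[OF assms(1)] sym power2_eq_square algebra_simps)
  also have "\<dots> = of_nat (card ?L) * det X - (\<Sum>(i, j)\<in>?L. ?t i j + ?t j i) - (\<Sum>(i, j)\<in>?L. ?e i j)"
    by (simp add: case_prod_unfold sum_subtractf)
  finally have off: "(\<Sum>(i, j)\<in>?L. det (zero_entries X i j)) + (\<Sum>(i, j)\<in>?L. ?e i j) =
      of_nat (card ?L) * det X - (\<Sum>(i, j)\<in>?L. ?t i j + ?t j i)"
    by simp
  have diag: "(\<Sum>i<n. det (zero_entries X i i)) = of_nat n * det X - (\<Sum>i<n. ?t i i)"
    by (simp add: det_zero_entries_diag[OF assms(1)] sum_subtractf)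
  have "(\<Sum>i<n. \<Sum>j<n. ?t i j) = of_nat n * det X"
    by (simp flip: laplace_expansion_row[OF assms(1)])
  then have total: "(\<Sum>i<n. ?t i i) + (\<Sum>(i, j)\<in>?L. ?t i j + ?t j i) = of_nat n * det X"
    by (simp add: sum_square)
  \<comment> \<open>Splitting the sum of ones over the square counts \<open>?L\<close>.\<close>
  have "n * n = n + 2 * card ?L"
    using sum_square[where n = n and f = "\<lambda>_ _. 1 :: nat"]
    by (simp add: case_prod_unfold)
  then have "(of_nat n)\<^sup>2 = (of_nat n + 2 * of_nat (card ?L) :: complex)"
    by (metis of_nat_add of_nat_mult of_nat_numeral power2_eq_square)
  then have "1 / 2 * ((of_nat n)\<^sup>2 - of_nat n) * det X = of_nat (card ?L) * det X"
    by simp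
  also have "\<dots> = (\<Sum>i<n. det (zero_entries X i i)) +
      ((\<Sum>(i, j)\<in>?L. det (zero_entries X i j)) + (\<Sum>(i, j)\<in>?L. ?e i j))"
    unfolding diag off by (simp flip: total)
  finally show ?thesis
    by (simp only: sum_triangle add.assoc)
qed

end
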